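(* Let $\mathcal{H}_A$ be a finite-dimensional complex Hilbert space with a fixed orthonormal basis $\{|j\rangle\}$, and let $\mathcal{H}_{A'}$, $\mathcal{H}_{A''}$ be copies of $\mathcal{H}_A$. Suppose that $\mathcal{E}_{A'A''|A}:\mathfrak{L}(\mathcal{H}_A)\to\mathfrak{L}(\mathcal{H}_{A'}\otimes\mathcal{H}_{A''})$ is a trace-preserving completely positive map that is broadcasting for a two-element ensemble of density operators $\{(p,\sigma_1),(1-p,\sigma_2)\}$, $0<p<1$, on $\mathcal{H}_A$ such that $[\sigma_1,\sigma_2]\neq0$. Let $\rho_A=p\sigma_1+(1-p)\sigma_2$ and let $\tau_{AA'A''}$ be the tripartite state isomorphic to $(\rho_A,\mathcal{E}^r_{A'A''|A})$. Then $\tau_{AA'A''}$ can be transformed by local operations, with nonzero probability of success, into a state whose reduced states on $AA'$ and on $AA''$ are both pure and entangled.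
   Context: $\mathfrak{L}(\mathcal{H})$ is the space of linear operators on $\mathcal{H}$. A trace-preserving completely positive map $\mathcal{E}_{A'A''|A}$ is broadcasting for a density operator $\rho$ on $\mathcal{H}_A$ if $\mathrm{Tr}_{A''}(\mathcal{E}_{A'A''|A}(\rho))=\rho$ and $\mathrm{Tr}_{A'}(\mathcal{E}_{A'A''|A}(\rho))=\rho$ (identifying the three copies of the Hilbert space); it is broadcasting for an ensemble $\{(p_j,\rho_j)\}$ if it is broadcasting for every $\rho_j$. Isomorphic state: for a density operator $\rho_A$ on $\mathcal{H}_A$ and a trace-preserving completely positive map $\mathcal{E}_{B|A}:\mathfrak{L}(\mathcal{H}_A)\to\mathfrak{L}(\mathcal{H}_B)$ (here $B$ is the composite system $A'A''$), with $\mathcal{E}^r_{B|A}$ the restriction of $\mathcal{E}_{B|A}$ to operators supported on the support of $\rho_A$, the state isomorphic to $(\rho_A,\mathcal{E}^r_{B|A})$ is $\tau_{AB}=(\mathcal{I}_A\otimes\mathcal{E}^r_{B|C})(|\Phi\rangle\langle\Phi|_{AC})$, where $C$ is an auxiliary copy of $A$, $\mathcal{I}_A$ is the identity map on $\mathfrak{L}(\mathcal{H}_A)$, $\mathcal{E}^r_{B|C}$ is $\mathcal{E}^r_{B|A}$ applied to $C$, and $|\Phi\rangle_{AC}=((\rho_A^T)^{1/2}\otimes I_C)\sum_j|j\rangle_A\otimes|j\rangle_C$, with $^T$ the transpose in the basis $\{|j\rangle\}$. "Can be transformed by local operations with nonzero probability of success" means: there are completely positive trace-nonincreasing maps $\mathcal{F}_A,\mathcal{F}_{A'},\mathcal{F}_{A''}$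 acting on the operators on $\mathcal{H}_A,\mathcal{H}_{A'},\mathcal{H}_{A''}$ respectively (with possibly different finite-dimensional output spaces) such that $\omega=(\mathcal{F}_A\otimes\mathcal{F}_{A'}\otimes\mathcal{F}_{A''})(\tau_{AA'A''})$ has $\mathrm{Tr}\,\omega>0$; the resulting state is $\omega/\mathrm{Tr}\,\omega$. A pure bipartite state is entangled if it is not a product state, i.e. its Schmidt rank is at least 2. *)

theory Defs
  imports "Jordan_Normal_Form.Matrix_Kernel" "Jordan_Normal_Form.Conjugate"
begin

text \<open>
  A Hilbert space of dimension \<open>n\<close> with a fixed orthonormal basis is \<open>carrier_vec n\<close> over the complex
  numbers, and the operators on it are \<open>carrier_mat n n\<close>. The basis vector \<open>|i\<rangle> \<otimes> |k\<rangle>\<close> of a tensor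
  product with factors of dimension \<open>a\<close> and \<open>b\<close> has index \<open>i * b + k\<close>, so that the tensor product
  is strictly associative. The form \<open>v \<bullet>c w\<close> is conjugate-linear in \<open>w\<close>. The order on
  complex numbers is that of \<^theory>\<open>HOL-Library.Complex_Order\<close>: \<open>0 \<le> z\<close> includes that \<open>z\<close> is real.
\<close>

definition kron_mat :: "complex mat \<Rightarrow> complex mat \<Rightarrow> complex mat" where
  "kron_mat A B = mat (dim_row A * dim_row B) (dim_col A * dim_col B)
     (\<lambda>(r, s). A $$ (r div dim_row B, s div dim_col B) * B $$ (r mod dim_row B, s mod dim_col B))"

definition kron_vec :: "complex vec \<Rightarrow> complex vec \<Rightarrow> complex vec" where
  "kron_vec v w = vec (dim_vec v * dim_vec w) (\<lambda>r. v $ (r div dim_vec w) * w $ (r mod dim_vec w))"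

definition ket_bra :: "complex vec \<Rightarrow> complex vec \<Rightarrow> complex mat" where
  "ket_bra v w = mat (dim_vec v) (dim_vec w) (\<lambda>(i, j). v $ i * conjugate (w $ j))"

definition mat_trace :: "complex mat \<Rightarrow> complex" where
  "mat_trace A = (\<Sum>i<dim_row A. A $$ (i, i))"

definition positive_op :: "nat \<Rightarrow> complex mat \<Rightarrow> bool" where
  "positive_op n A \<longleftrightarrow> A \<in> carrier_mat n n \<and> (\<forall>v \<in> carrier_vec n. 0 \<le> (A *\<^sub>v v) \<bullet>c v)"

definition density_op :: "nat \<Rightarrow> complex mat \<Rightarrow> bool" where
  "density_op n \<rho> \<longleftrightarrow> positive_op n \<rho> \<and> mat_trace \<rho> = 1"

definition positive_sqrt :: "nat \<Rightarrow> complex mat \<Rightarrow> complex mat" where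
  "positive_sqrt n A = (THE S. positive_op n S \<and> S * S = A)"

definition ptrace_fst :: "nat \<Rightarrow> nat \<Rightarrow> complex mat \<Rightarrow> complex mat" where
  "ptrace_fst a b M = mat b b (\<lambda>(k, l). \<Sum>i<a. M $$ (i * b + k, i * b + l))"

definition ptrace_snd :: "nat \<Rightarrow> nat \<Rightarrow> complex mat \<Rightarrow> complex mat" where
  "ptrace_snd a b M = mat a a (\<lambda>(i, j). \<Sum>k<b. M $$ (i * b + k, j * b + k))"

definition mat_unit :: "nat \<Rightarrow> nat \<Rightarrow> nat \<Rightarrow> complex mat" where
  "mat_unit a i j = ket_bra (unit_vec a i) (unit_vec a j)"

definition mat_block :: "nat \<Rightarrow> complex mat \<Rightarrow> nat \<Rightarrow> nat \<Rightarrow> complex mat" where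
  "mat_block b M i j = mat b b (\<lambda>(k, l). M $$ (i * b + k, j * b + l))"

text \<open>
  The tensor product of linear maps \<open>F\<close> (from dimension \<open>a\<close> to \<open>a'\<close>) and \<open>G\<close> (from \<open>b\<close> to \<open>b'\<close>).
  Writing \<open>M = (\<Sum>i j. |i\<rangle>\<langle>j| \<otimes> M\<^sub>i\<^sub>j)\<close> with blocks \<open>M\<^sub>i\<^sub>j\<close>, its value at \<open>M\<close> is
  \<open>\<Sum>i j. F(|i\<rangle>\<langle>j|) \<otimes> G(M\<^sub>i\<^sub>j)\<close>. Applying \<open>G\<close> to whole blocks, rather than expanding it in matrix
  units, makes this meaningful also when \<open>G\<close> is only defined on the operators on a subspace
  to which all \<open>M\<^sub>i\<^sub>j\<close> belong. The sum is spelled out entrywise because the type of matrices is not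
  an additive monoid.
\<close>

definition tensor_map :: "nat \<Rightarrow> nat \<Rightarrow> nat \<Rightarrow> nat \<Rightarrow> (complex mat \<Rightarrow> complex mat) \<Rightarrow>
    (complex mat \<Rightarrow> complex mat) \<Rightarrow> complex mat \<Rightarrow> complex mat" where
  "tensor_map a a' b b' F G M = mat (a' * b') (a' * b')
     (\<lambda>(r, s). \<Sum>i<a. \<Sum>j<a. kron_mat (F (mat_unit a i j)) (G (mat_block b M i j)) $$ (r, s))"

definition linear_map :: "nat \<Rightarrow> nat \<Rightarrow> (complex mat \<Rightarrow> complex mat) \<Rightarrow> bool" where
  "linear_map n m F \<longleftrightarrow>
     (\<forall>X \<in> carrier_mat n n. F X \<in> carrier_mat m m) \<and>
     (\<forall>X \<in> carrier_mat n n. \<forall>Y \<in> carrier_mat n n. F (X + Y) = F X + F Y) \<and>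
     (\<forall>c. \<forall>X \<in> carrier_mat n n. F (c \<cdot>\<^sub>m X) = c \<cdot>\<^sub>m F X)"

definition completely_positive :: "nat \<Rightarrow> nat \<Rightarrow> (complex mat \<Rightarrow> complex mat) \<Rightarrow> bool" where
  "completely_positive n m F \<longleftrightarrow> linear_map n m F \<and>
     (\<forall>k X. positive_op (k * n) X \<longrightarrow> positive_op (k * m) (tensor_map k k n m (\<lambda>Z. Z) F X))"

definition trace_preserving :: "nat \<Rightarrow> (complex mat \<Rightarrow> complex mat) \<Rightarrow> bool" where
  "trace_preserving n F \<longleftrightarrow> (\<forall>X \<in> carrier_mat n n. mat_trace (F X) = mat_trace X)"

definition trace_nonincreasing :: "nat \<Rightarrow> (complex mat \<Rightarrow> complex mat) \<Rightarrow> bool" where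
  "trace_nonincreasing n F \<longleftrightarrow> (\<forall>X. positive_op n X \<longrightarrow> mat_trace (F X) \<le> mat_trace X)"

definition broadcasting :: "nat \<Rightarrow> (complex mat \<Rightarrow> complex mat) \<Rightarrow> complex mat \<Rightarrow> bool" where
  "broadcasting n E \<rho> \<longleftrightarrow> ptrace_snd n n (E \<rho>) = \<rho> \<and> ptrace_fst n n (E \<rho>) = \<rho>"

definition broadcasting_ensemble ::
    "nat \<Rightarrow> (complex mat \<Rightarrow> complex mat) \<Rightarrow> (real \<times> complex mat) set \<Rightarrow> bool" where
  "broadcasting_ensemble n E S \<longleftrightarrow> (\<forall>(p, \<rho>) \<in> S. broadcasting n E \<rho>)"

definition orth_compl :: "nat \<Rightarrow> complex vec set \<Rightarrow> complex vec set" where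
  "orth_compl n W = {v \<in> carrier_vec n. \<forall>w \<in> W. v \<bullet>c w = 0}"

definition support :: "nat \<Rightarrow> complex mat \<Rightarrow> complex vec set" where
  "support n \<rho> = orth_compl n (mat_kernel \<rho>)"

definition ops_supported_on :: "nat \<Rightarrow> complex vec set \<Rightarrow> complex mat set" where
  "ops_supported_on n W = {X \<in> carrier_mat n n.
     (\<forall>v \<in> carrier_vec n. X *\<^sub>v v \<in> W) \<and> (\<forall>v \<in> orth_compl n W. X *\<^sub>v v = 0\<^sub>v n)}"

definition restrict_to_support ::
    "nat \<Rightarrow> complex mat \<Rightarrow> (complex mat \<Rightarrow> complex mat) \<Rightarrow> complex mat \<Rightarrow> complex mat" where
  "restrict_to_support n \<rho> E = restrict E (ops_supported_on n (support n \<rho>))"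

definition Phi_vec :: "nat \<Rightarrow> complex mat \<Rightarrow> complex vec" where
  "Phi_vec n \<rho> = kron_mat (positive_sqrt n (transpose_mat \<rho>)) (1\<^sub>m n) *\<^sub>v
     vec (n * n) (\<lambda>r. \<Sum>j<n. kron_vec (unit_vec n j) (unit_vec n j) $ r)"

definition isomorphic_state :: "nat \<Rightarrow> nat \<Rightarrow> complex mat \<Rightarrow> (complex mat \<Rightarrow> complex mat) \<Rightarrow> complex mat" where
  "isomorphic_state n m \<rho> E =
     tensor_map n n n m (\<lambda>Z. Z) (restrict_to_support n \<rho> E) (ket_bra (Phi_vec n \<rho>) (Phi_vec n \<rho>))"

definition local_operation :: "nat \<Rightarrow> nat \<Rightarrow> (complex mat \<Rightarrow> complex mat) \<Rightarrow> bool" where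
  "local_operation n m F \<longleftrightarrow> completely_positive n m F \<and> trace_nonincreasing n F"

text \<open>
  \<open>locally_transformable (n1, n2, n3) \<tau> (m1, m2, m3) \<theta>\<close>: the tripartite state \<open>\<tau>\<close> with local
  dimensions \<open>n1, n2, n3\<close> can be transformed by local operations, with nonzero probability of
  success, into the state \<open>\<theta>\<close> with local dimensions \<open>m1, m2, m3\<close>.
\<close>

definition locally_transformable ::
    "nat \<times> nat \<times> nat \<Rightarrow> complex mat \<Rightarrow> nat \<times> nat \<times> nat \<Rightarrow> complex mat \<Rightarrow> bool" where
  "locally_transformable = (\<lambda>(n1, n2, n3) \<tau> (m1, m2, m3) \<theta>.
     \<exists>F1 F2 F3 \<omega>. local_operation n1 m1 F1 \<and> local_operation n2 m2 F2 \<and> local_operation n3 m3 F3 \<and>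
       \<omega> = tensor_map n1 m1 (n2 * n3) (m2 * m3) F1 (tensor_map n2 m2 n3 m3 F2 F3) \<tau> \<and>
       0 < mat_trace \<omega> \<and> \<theta> = (1 / mat_trace \<omega>) \<cdot>\<^sub>m \<omega>)"

definition reduced_12 :: "nat \<times> nat \<times> nat \<Rightarrow> complex mat \<Rightarrow> complex mat" where
  "reduced_12 = (\<lambda>(a, b, c) \<theta>. tensor_map a a (b * c) b (\<lambda>Z. Z) (ptrace_snd b c) \<theta>)"

definition reduced_13 :: "nat \<times> nat \<times> nat \<Rightarrow> complex mat \<Rightarrow> complex mat" where
  "reduced_13 = (\<lambda>(a, b, c) \<theta>. tensor_map a a (b * c) c (\<lambda>Z. Z) (ptrace_fst b c) \<theta>)"

definition pure_state :: "nat \<Rightarrow> complex mat \<Rightarrow> bool" where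
  "pure_state n \<theta> \<longleftrightarrow> (\<exists>\<psi> \<in> carrier_vec n. \<psi> \<bullet>c \<psi> = 1 \<and> \<theta> = ket_bra \<psi> \<psi>)"

definition product_state :: "nat \<Rightarrow> nat \<Rightarrow> complex mat \<Rightarrow> bool" where
  "product_state a b \<theta> \<longleftrightarrow> (\<exists>\<alpha> \<beta>. density_op a \<alpha> \<and> density_op b \<beta> \<and> \<theta> = kron_mat \<alpha> \<beta>)"

definition pure_entangled :: "nat \<Rightarrow> nat \<Rightarrow> complex mat \<Rightarrow> bool" where
  "pure_entangled a b \<theta> \<longleftrightarrow> pure_state (a * b) \<theta> \<and> \<not> product_state a b \<theta>"

end

theory Submission
  imports Defs "Jordan_Normal_Form.Schur_Decomposition" "HOL-Library.Function_Algebras"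
begin

text \<open>
  The hypotheses are contradictory: the conclusion violates the monogamy of entanglement, and indeed
  states with a common broadcasting map commute (no-broadcasting), which is shown directly. Put
  \<open>A = \<sigma>\<^sub>1\<close> and let \<open>X\<close> play the role of \<open>\<rho>\<^sup>-\<^sup>1 A\<close> on the support of \<open>\<rho>\<close>, so that \<open>\<rho> X = A\<close>. For a
  Stinespring isometry \<open>V\<close> of \<open>E\<close>, broadcasting of \<open>\<rho>\<close> and \<open>A\<close> gives the three terms in the
  expansion of the Hilbert-Schmidt norm of \<open>(X\<^sup>\<dagger> \<otimes> 1) V \<surd>\<rho> - V X\<^sup>\<dagger> \<surd>\<rho>\<close> the same value, so that this
  difference vanishes. From this the same follows for \<open>X\<close> in place of \<open>X\<^sup>\<dagger>\<close>, and both statements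
  also hold for the other receiver. As \<open>X \<otimes> 1\<close> commutes with \<open>1 \<otimes> X\<^sup>\<dagger>\<close>, it follows that
  \<open>tr (\<rho> X X\<^sup>\<dagger>) = tr (\<rho> X\<^sup>\<dagger> X)\<close>. Together with \<open>\<rho> X = X\<^sup>\<dagger> \<rho>\<close> this makes \<open>tr (Y\<^sup>\<dagger> \<rho> Y)\<close> zero for
  \<open>Y = X - X\<^sup>\<dagger>\<close>; hence \<open>\<rho> Y = 0\<close> and \<open>A = \<rho> X = \<rho> X\<^sup>\<dagger> = X \<rho>\<close> commutes with \<open>\<rho>\<close>. Complete positivity of
  \<open>E\<close> on blocks replaces \<open>V\<close> and \<open>\<surd>\<rho>\<close> in the formal argument.
\<close>

subsection \<open>Matrices\<close>

notation mat_adjoint ("_\<^sup>\<dagger>" [1000] 1000)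

lemma mat_adjoint_carrier [simp, intro]:
  "A \<in> carrier_mat n m \<Longrightarrow> A\<^sup>\<dagger> \<in> carrier_mat m n"
  by (auto simp: mat_adjoint_def)

lemma mat_adjoint_dims [simp]: "dim_row (A\<^sup>\<dagger>) = dim_col A" "dim_col (A\<^sup>\<dagger>) = dim_row A"
  by (auto simp: mat_adjoint_def)

lemma mat_adjoint_index [simp]:
  fixes A :: "complex mat"
  shows "i < dim_col A \<Longrightarrow> j < dim_row A \<Longrightarrow> A\<^sup>\<dagger> $$ (i, j) = cnj (A $$ (j, i))"
  by (simp add: mat_adjoint_def mat_of_rows_def)

lemma mat_adjoint_adjoint [simp]: "A\<^sup>\<dagger>\<^sup>\<dagger> = (A :: complex mat)"
  by (rule eq_matI) auto

lemma mat_adjoint_mult: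
  fixes A B :: "complex mat"
  assumes "A \<in> carrier_mat n m" "B \<in> carrier_mat m k"
  shows "(A * B)\<^sup>\<dagger> = B\<^sup>\<dagger> * A\<^sup>\<dagger>"
  using assms by (intro eq_matI) (auto simp: scalar_prod_def intro!: sum.cong)

lemma mat_adjoint_minus:
  fixes A B :: "complex mat"
  assumes "A \<in> carrier_mat n m" "B \<in> carrier_mat n m"
  shows "(A - B)\<^sup>\<dagger> = A\<^sup>\<dagger> - B\<^sup>\<dagger>"
  using assms by (intro eq_matI) auto

lemma mult_vec_cscalar_prod:
  fixes M :: "complex mat"
  assumes "M \<in> carrier_mat n m" "v \<in> carrier_vec m" "w \<in> carrier_vec n"
  shows "(M *\<^sub>v v) \<bullet>c w = v \<bullet>c (M\<^sup>\<dagger> *\<^sub>v w)"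
  using assms
  by (auto simp: scalar_prod_def sum_distrib_left sum_distrib_right ac_simps intro: sum.swap)

section \<open>Generalized inverses of square matrices\<close>

lemma sum_fun_apply:
  fixes F :: "'a \<Rightarrow> 'b \<Rightarrow> 'c :: comm_monoid_add"
  shows "(\<Sum>l\<in>S. F l) i = (\<Sum>l\<in>S. F l i)"
  by (induction S rule: infinite_finite_induct) auto

text \<open>Every linear map \<open>f\<close> between vector spaces has a linear \<open>g\<close>
  with \<open>f (g (f v)) = f v\<close>. Coordinates are extended to functions on all naturals so
  that the space fills a type; \<open>f\<close> reads only the first \<open>n\<close> of them and
  vanishes at the others, so the truncation of \<open>g\<close> to the matrix \<open>H\<close> loses
  nothing.\<close>

lemma generalized_inverse:
  fixes M :: "complex mat"
  assumes M: "M \<in> carrier_mat n n"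
  obtains H where "H \<in> carrier_mat n n" "M * H * M = M"
proof -
  define s where "s = (\<lambda>(c::complex) (v :: nat \<Rightarrow> complex) i. c * v i)"
  interpret V: vector_space s
    by standard (auto simp: s_def algebra_simps fun_eq_iff)
  define f where "f v = (\<lambda>i. \<Sum>j<n. (if i < n then M $$ (i, j) else 0) * v j)" for v
  have f: "Vector_Spaces.linear s s f"
    by standard (auto simp: f_def s_def algebra_simps fun_eq_iff sum.distrib sum_distrib_left)
  interpret P: vector_space_pair s s ..
  obtain g where g: "Vector_Spaces.linear s s g" "\<And>v. f (g (f v)) = f v"
    using P.linear_exists_right_inverse_on[OF f V.subspace_UNIV] by auto
  interpret g: Vector_Spaces.linear s s g by (fact g)
  define e where "e k = (\<lambda>i::nat. if i = k then 1 else 0 :: complex)" for k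
  define H where "H = mat n n (\<lambda>(i, j). g (e j) i)"
  have f_e: "f (e k) = (\<lambda>i. if i < n then M $$ (i, k) else 0)" if "k < n" for k
    using that by (auto simp: f_def e_def fun_eq_iff if_distrib cong: if_cong)
  \<comment> \<open>Column \<open>k\<close> of \<open>M\<close> as a combination of finitely many
    \<open>e l\<close>: linearity of \<open>g\<close> then expresses \<open>g (f (e k))\<close>
    through the columns of \<open>H\<close>.\<close>
  have f_sum: "f (e k) = (\<Sum>l<n. s (M $$ (l, k)) (e l))" if "k < n" for k
  proof
    fix i show "f (e k) i = (\<Sum>l<n. s (M $$ (l, k)) (e l)) i"
      unfolding f_e[OF that] sum_fun_apply
      by (simp add: s_def e_def if_distrib sum.delta' cong: if_cong)
  qed
  have "M * (H * M) = M"
  proof (rule eq_matI)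
    fix i k assume "i < dim_row M" "k < dim_col M"
    then have i: "i < n" and k: "k < n" using M by auto
    have HM: "(H * M) $$ (j, k) = g (f (e k)) j" if "j < n" for j
      unfolding f_sum[OF k] g.sum g.scale sum_fun_apply
      using that k M by (simp add: H_def s_def scalar_prod_def lessThan_atLeast0 mult.commute)
    have "(M * (H * M)) $$ (i, k) = (\<Sum>j<n. M $$ (i, j) * (H * M) $$ (j, k))"
      using i k M by (simp add: H_def scalar_prod_def lessThan_atLeast0 del: index_mult_mat(1))
        (simp add: index_mult_mat(1) scalar_prod_def H_def)
    also have "\<dots> = f (g (f (e k))) i"
      using i by (simp add: f_def[of "g (f (e k))"] HM)
    also have "\<dots> = M $$ (i, k)" using i k g(2)[of "e k"] by (simp add: f_e)
    finally show "(M * (H * M)) $$ (i, k) = M $$ (i, k)" .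
  qed (use M in \<open>auto simp: H_def\<close>)
  then show thesis
    using M by (intro that[of H]) (auto simp: H_def assoc_mult_mat[of _ n n _ n _ n])
qed

section \<open>Traces\<close>

lemma mat_trace_mult:
  assumes "A \<in> carrier_mat n m" "B \<in> carrier_mat m n"
  shows "mat_trace (A * B) = (\<Sum>i<n. \<Sum>j<m. A $$ (i, j) * B $$ (j, i))"
  using assms by (auto simp: mat_trace_def scalar_prod_def lessThan_atLeast0)

lemma mat_trace_comm:
  assumes "A \<in> carrier_mat n m" "B \<in> carrier_mat m n"
  shows "mat_trace (A * B) = mat_trace (B * A)"
  unfolding mat_trace_mult[OF assms] mat_trace_mult[OF assms(2,1)]
  by (subst sum.swap) (simp add: mult.commute)

lemma mat_trace_minus:
  assumes "A \<in> carrier_mat n n" "B \<in> carrier_mat n n"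
  shows "mat_trace (A - B) = mat_trace A - mat_trace B"
  using assms by (auto simp: mat_trace_def sum_subtractf)

lemma mat_trace_adjoint:
  assumes "A \<in> carrier_mat n n"
  shows "mat_trace (A\<^sup>\<dagger>) = cnj (mat_trace A)"
  using assms by (auto simp: mat_trace_def)

text \<open>With \<open>L = N\<close> each summand is a value of the quadratic form of
  \<open>M\<close>, so that facts about positive operators on vectors carry over to traces, column
  by column.\<close>

lemma mat_trace_sandwich:
  assumes "M \<in> carrier_mat n m" "N \<in> carrier_mat m k" "L \<in> carrier_mat n k"
  shows "mat_trace (L\<^sup>\<dagger> * (M * N)) = (\<Sum>c<k. (M *\<^sub>v col N c) \<bullet>c col L c)"
  using assms
  by (auto simp: mat_trace_def scalar_prod_def mult.commute intro!: sum.cong)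

subsection \<open>Positive operators\<close>

lemma quadratic_form_add_smult:
  fixes P :: "complex mat"
  assumes P: "P \<in> carrier_mat n n" and u: "u \<in> carrier_vec n" and w: "w \<in> carrier_vec n"
  shows "(P *\<^sub>v (u + c \<cdot>\<^sub>v w)) \<bullet>c (u + c \<cdot>\<^sub>v w)
    = (P *\<^sub>v u) \<bullet>c u + cnj c * ((P *\<^sub>v u) \<bullet>c w) + c * ((P *\<^sub>v w) \<bullet>c u)
      + c * cnj c * ((P *\<^sub>v w) \<bullet>c w)"
proof -
  have "P *\<^sub>v (u + c \<cdot>\<^sub>v w) = P *\<^sub>v u + c \<cdot>\<^sub>v (P *\<^sub>v w)"
    using P u w by (simp add: mult_add_distrib_mat_vec[of _ n n] mult_mat_vec[of _ n n])
  moreover have "P *\<^sub>v u \<in> carrier_vec n" "P *\<^sub>v w \<in> carrier_vec n" using P u w by auto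
  moreover have "(x + c \<cdot>\<^sub>v y) \<bullet>c (u + c \<cdot>\<^sub>v w)
      = x \<bullet>c u + cnj c * (x \<bullet>c w) + c * (y \<bullet>c u) + c * cnj c * (y \<bullet>c w)"
    if "x \<in> carrier_vec n" "y \<in> carrier_vec n" for x y
    using that u w by (simp add: scalar_prod_def sum.distrib sum_distrib_left algebra_simps)
  ultimately show ?thesis by simp
qed

text \<open>Polarization: a nonnegative form is in particular real, so its cross terms at
  \<open>u + c w\<close> have a real sum. The values \<open>c = 1\<close> and
  \<open>c = \<i>\<close> together force the two off-diagonal entries to be conjugate.\<close>

lemma positive_op_hermitian:
  assumes "positive_op n P"
  shows "P\<^sup>\<dagger> = P"
proof (rule eq_matI)
  have P: "P \<in> carrier_mat n n" and pos: "\<And>v. v \<in> carrier_vec n \<Longrightarrow> Im ((P *\<^sub>v v) \<bullet>c v) = 0"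
    using assms by (auto simp: positive_op_def less_eq_complex_def)
  fix i j assume "i < dim_row P" "j < dim_col P"
  then have ij: "i < n" "j < n" using P by auto
  let ?u = "unit_vec n i :: complex vec" and ?w = "unit_vec n j :: complex vec"
  have "Im (cnj c * ((P *\<^sub>v ?u) \<bullet>c ?w) + c * ((P *\<^sub>v ?w) \<bullet>c ?u)) = 0" for c
    using pos[of "?u + c \<cdot>\<^sub>v ?w"] pos[of ?u] pos[of ?w]
    by (simp add: quadratic_form_add_smult[OF P])
  from this[of 1] this[of \<i>]
  have "(P *\<^sub>v ?w) \<bullet>c ?u = cnj ((P *\<^sub>v ?u) \<bullet>c ?w)" by (auto simp: complex_eq_iff)
  moreover have "(P *\<^sub>v unit_vec n l) \<bullet>c unit_vec n k = P $$ (k, l)" if "k < n" "l < n" for k l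
  proof -
    have "conjugate (unit_vec n k) = (unit_vec n k :: complex vec)"
      by (rule eq_vecI) (auto simp: unit_vec_def)
    then show ?thesis using that P by simp
  qed
  ultimately show "P\<^sup>\<dagger> $$ (i, j) = P $$ (i, j)"
    using ij P by simp
qed (use assms in \<open>auto simp: positive_op_def\<close>)

text \<open>Moving from \<open>u\<close> in the direction \<open>- P u\<close> lowers the form to
  first order unless \<open>P u\<close> vanishes, but the form starts at its minimum 0.\<close>

lemma positive_op_null:
  assumes P: "positive_op n P" and u: "u \<in> carrier_vec n" and "(P *\<^sub>v u) \<bullet>c u = 0"
  shows "P *\<^sub>v u = 0\<^sub>v n"
proof -
  have Pc: "P \<in> carrier_mat n n" using P by (simp add: positive_op_def)
  define w where "w = P *\<^sub>v u"
  have w: "w \<in> carrier_vec n" using Pc u by (simp add: w_def)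
  have Pw: "P *\<^sub>v w \<in> carrier_vec n" using Pc w by simp
  define s q where "s = Re (w \<bullet>c w)" and "q = Re ((P *\<^sub>v w) \<bullet>c w)"
  have s: "w \<bullet>c w = of_real s" "0 \<le> s"
    using conjugate_square_ge_0_vec[of w] by (auto simp: s_def less_eq_complex_def complex_eq_iff)
  have q: "(P *\<^sub>v w) \<bullet>c w = of_real q" "0 \<le> q"
    using P w by (auto simp: q_def positive_op_def less_eq_complex_def complex_eq_iff)
  have cross: "(P *\<^sub>v w) \<bullet>c u = of_real s"
    using mult_vec_cscalar_prod[OF Pc w u] s(1) positive_op_hermitian[OF P] by (simp add: w_def)
  \<comment> \<open>The form at \<open>u - t w\<close> is the parabola
    \<open>t * (t * q - 2 * s)\<close>, with its minimum at \<open>s / q\<close>. The denominator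
    \<open>q + 1\<close> avoids division by zero and still makes the value negative for positive
    \<open>s\<close>.\<close>
  define t where "t = s / (q + 1)"
  let ?c = "complex_of_real (- t)"
  let ?v = "u + ?c \<cdot>\<^sub>v w"
  have v: "?v \<in> carrier_vec n" using u w by simp
  have "0 \<le> (P *\<^sub>v ?v) \<bullet>c ?v" using P v by (simp add: positive_op_def)
  also have "\<dots> = of_real (t * (t * q - 2 * s))"
    unfolding quadratic_form_add_smult[OF Pc u w]
    using assms(3) by (simp add: s q cross w_def[symmetric] algebra_simps)
  finally have "0 \<le> t * (t * q - 2 * s)" by (simp add: less_eq_complex_def)
  moreover have "t * q \<le> s" using s(2) q(2) by (simp add: t_def field_simps)
  moreover have "0 < t" if "0 < s" using that q(2) by (simp add: t_def)
  ultimately have "s = 0"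
    using s(2) by (smt (verit) mult_pos_neg)
  then have "w = 0\<^sub>v n" using s(1) w by simp
  then show ?thesis by (simp add: w_def)
qed

lemma positive_op_sandwich:
  assumes P: "positive_op n P" and S: "S \<in> carrier_mat m n"
  shows "positive_op m (S * P * S\<^sup>\<dagger>)"
  unfolding positive_op_def
proof (intro conjI ballI)
  have Pc: "P \<in> carrier_mat n n" using P by (simp add: positive_op_def)
  show "S * P * S\<^sup>\<dagger> \<in> carrier_mat m m" using Pc S by auto
  fix v :: "complex vec" assume v: "v \<in> carrier_vec m"
  have S': "S\<^sup>\<dagger> \<in> carrier_mat n m" using S by simp
  have w: "S\<^sup>\<dagger> *\<^sub>v v \<in> carrier_vec n" using S' v by simp
  have "(S * P * S\<^sup>\<dagger>) *\<^sub>v v = S *\<^sub>v (P *\<^sub>v (S\<^sup>\<dagger> *\<^sub>v v))"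
    using S Pc S' v w by (simp add: assoc_mult_mat_vec[of _ m n _ m] assoc_mult_mat_vec[of _ m n _ n])
  then have "((S * P * S\<^sup>\<dagger>) *\<^sub>v v) \<bullet>c v = (P *\<^sub>v (S\<^sup>\<dagger> *\<^sub>v v)) \<bullet>c (S\<^sup>\<dagger> *\<^sub>v v)"
    using mult_vec_cscalar_prod[OF S _ v] Pc w by simp
  also have "0 \<le> \<dots>" using P w by (simp add: positive_op_def)
  finally show "0 \<le> ((S * P * S\<^sup>\<dagger>) *\<^sub>v v) \<bullet>c v" .
qed

text \<open>The trace is a sum of nonnegative values of the form at the columns of \<open>Y\<close>,
  so each value is 0 and \<open>P\<close> annihilates each column.\<close>

lemma positive_op_trace_null:
  assumes P: "positive_op n P" and Y: "Y \<in> carrier_mat n n" and "mat_trace (Y\<^sup>\<dagger> * (P * Y)) = 0"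
  shows "P * Y = 0\<^sub>m n n"
proof (rule eq_matI)
  have Pc: "P \<in> carrier_mat n n" using P by (simp add: positive_op_def)
  have "(\<Sum>c<n. (P *\<^sub>v col Y c) \<bullet>c col Y c) = 0"
    using mat_trace_sandwich[OF Pc Y Y] assms(3) by simp
  moreover have "0 \<le> (P *\<^sub>v col Y c) \<bullet>c col Y c" for c
    using P Y by (auto simp: positive_op_def)
  ultimately have "(P *\<^sub>v col Y c) \<bullet>c col Y c = 0" if "c < n" for c
    using that sum_nonneg_eq_0_iff[of "{..<n}" "\<lambda>c. (P *\<^sub>v col Y c) \<bullet>c col Y c"] by auto
  then have null: "P *\<^sub>v col Y c = 0\<^sub>v n" if "c < n" for c
    using that Y by (intro positive_op_null[OF P]) auto
  fix i c assume "i < dim_row (0\<^sub>m n n :: complex mat)" "c < dim_col (0\<^sub>m n n :: complex mat)"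
  then have "i < n" "c < n" by auto
  then have "(P * Y) $$ (i, c) = (P *\<^sub>v col Y c) $ i" using Pc Y by auto
  then show "(P * Y) $$ (i, c) = 0\<^sub>m n n $$ (i, c)" using null \<open>i < n\<close> \<open>c < n\<close> by simp
qed (use assms in \<open>auto simp: positive_op_def\<close>)

subsection \<open>Block matrices and complete positivity\<close>

lemma sum_blocks:
  fixes f :: "nat \<Rightarrow> 'a :: comm_monoid_add"
  shows "(\<Sum>r<k * n. f r) = (\<Sum>i<k. \<Sum>a<n. f (i * n + a))"
proof -
  have "(\<Sum>a<n. f (i * n + a)) = sum f {i * n..<i * n + n}" for i
    by (rule sum.reindex_bij_witness[of _ "\<lambda>r. r - i * n" "\<lambda>a. i * n + a"]) auto
  then show ?thesis by (simp add: sum.nat_group)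
qed

lemma block_index_less:
  fixes i a k n :: nat
  assumes "i < k" "a < n"
  shows "i * n + a < k * n"
proof -
  have "i * n + a < Suc i * n" using assms(2) by simp
  also have "\<dots> \<le> k * n" using assms(1) by (intro mult_le_mono1) simp
  finally show ?thesis .
qed

lemma block_div_mod_less:
  fixes r k n :: nat
  assumes "r < k * n"
  shows "r div n < k" "r mod n < n"
  using assms by (cases "n = 0"; simp add: less_mult_imp_div_less)+

text \<open>This is the sum of the operators |i><j| tensored with \<open>B i j\<close>, in the index
  convention of \<open>kron_mat\<close>.\<close>

definition block_mat :: "nat \<Rightarrow> nat \<Rightarrow> (nat \<Rightarrow> nat \<Rightarrow> complex mat) \<Rightarrow> complex mat" where
  "block_mat k n B = mat (k * n) (k * n) (\<lambda>(r, s). B (r div n) (s div n) $$ (r mod n, s mod n))"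

definition block_vec :: "nat \<Rightarrow> nat \<Rightarrow> (nat \<Rightarrow> complex vec) \<Rightarrow> complex vec" where
  "block_vec k n V = vec (k * n) (\<lambda>r. V (r div n) $ (r mod n))"

lemma block_mat_carrier [simp]: "block_mat k n B \<in> carrier_mat (k * n) (k * n)"
  by (simp add: block_mat_def)

lemma block_vec_carrier [simp]: "block_vec k n V \<in> carrier_vec (k * n)"
  by (simp add: block_vec_def)

lemma block_vec_index: "i < k \<Longrightarrow> a < n \<Longrightarrow> block_vec k n V $ (i * n + a) = V i $ a"
  by (simp add: block_vec_def block_index_less)

lemma block_mat_mult_vec_index:
  assumes "\<And>i j. i < k \<Longrightarrow> j < k \<Longrightarrow> B i j \<in> carrier_mat n n"
    and "\<And>j. j < k \<Longrightarrow> V j \<in> carrier_vec n" and "i < k" "a < n"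
  shows "(block_mat k n B *\<^sub>v block_vec k n V) $ (i * n + a) = (\<Sum>j<k. (B i j *\<^sub>v V j) $ a)"
proof -
  have "(block_mat k n B *\<^sub>v block_vec k n V) $ (i * n + a)
      = (\<Sum>r<k * n. block_mat k n B $$ (i * n + a, r) * block_vec k n V $ r)"
    using assms(3,4) by (simp add: scalar_prod_def lessThan_atLeast0 block_index_less block_mat_def block_vec_def)
  also have "\<dots> = (\<Sum>j<k. \<Sum>b<n. B i j $$ (a, b) * V j $ b)"
    unfolding sum_blocks using assms(3,4)
    by (intro sum.cong refl) (simp add: block_vec_index block_mat_def block_index_less)
  also have "\<dots> = (\<Sum>j<k. (B i j *\<^sub>v V j) $ a)"
    using assms(1)[OF assms(3)] assms(2,4)
    by (intro sum.cong refl) (auto simp: scalar_prod_def lessThan_atLeast0 carrier_matD[OF assms(1)[OF assms(3)]] carrier_vecD[OF assms(2)])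
  finally show ?thesis .
qed

lemma block_mat_quadratic_form:
  assumes "\<And>i j. i < k \<Longrightarrow> j < k \<Longrightarrow> B i j \<in> carrier_mat n n"
    and "\<And>j. j < k \<Longrightarrow> V j \<in> carrier_vec n"
  shows "(block_mat k n B *\<^sub>v block_vec k n V) \<bullet>c block_vec k n V
    = (\<Sum>i<k. \<Sum>j<k. (B i j *\<^sub>v V j) \<bullet>c V i)"
proof -
  have "(block_mat k n B *\<^sub>v block_vec k n V) \<bullet>c block_vec k n V
      = (\<Sum>r<k * n. (block_mat k n B *\<^sub>v block_vec k n V) $ r * cnj (block_vec k n V $ r))"
    by (simp add: scalar_prod_def lessThan_atLeast0 block_vec_def block_mat_def)
  also have "\<dots> = (\<Sum>i<k. \<Sum>a<n. (\<Sum>j<k. (B i j *\<^sub>v V j) $ a) * cnj (V i $ a))"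
    unfolding sum_blocks
    by (intro sum.cong refl) (simp add: block_mat_mult_vec_index[OF assms] block_vec_index)
  also have "\<dots> = (\<Sum>i<k. \<Sum>j<k. \<Sum>a<n. (B i j *\<^sub>v V j) $ a * cnj (V i $ a))"
    unfolding sum_distrib_right by (intro sum.cong refl sum.swap)
  also have "\<dots> = (\<Sum>i<k. \<Sum>j<k. (B i j *\<^sub>v V j) \<bullet>c V i)"
    by (intro sum.cong refl)
      (simp add: scalar_prod_def lessThan_atLeast0 carrier_vecD[OF assms(2)])
  finally show ?thesis .
qed

text \<open>Tensoring with the matrix unit |i><j| reaches only the block at \<open>(i, j)\<close>,
  so at each entry a single term of the double sum survives.\<close>

lemma tensor_map_block_mat:
  assumes B: "\<And>i j. i < k \<Longrightarrow> j < k \<Longrightarrow> B i j \<in> carrier_mat n n"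
    and E: "\<And>X. X \<in> carrier_mat n n \<Longrightarrow> E X \<in> carrier_mat m m"
  shows "tensor_map k k n m (\<lambda>Z. Z) E (block_mat k n B) = block_mat k m (\<lambda>i j. E (B i j))"
proof (rule eq_matI)
  fix r s
  assume "r < dim_row (block_mat k m (\<lambda>i j. E (B i j)))" "s < dim_col (block_mat k m (\<lambda>i j. E (B i j)))"
  then have r: "r < k * m" and s: "s < k * m" by (auto simp: block_mat_def)
  note rs = block_div_mod_less[OF r] block_div_mod_less[OF s]
  have blk: "mat_block n (block_mat k n B) i j = B i j" if "i < k" "j < k" for i j
    using that B[OF that] by (intro eq_matI) (auto simp: mat_block_def block_mat_def block_index_less)
  have "kron_mat (mat_unit k i j) (E (B i j)) $$ (r, s)
      = (if r div m = i then if s div m = j then E (B i j) $$ (r mod m, s mod m) else 0 else 0)"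
    if "i < k" "j < k" for i j
    using that rs r s E[OF B[OF that]] by (auto simp: kron_mat_def mat_unit_def ket_bra_def)
  then have "tensor_map k k n m (\<lambda>Z. Z) E (block_mat k n B) $$ (r, s)
      = (\<Sum>i<k. \<Sum>j<k. if r div m = i then if s div m = j then E (B i j) $$ (r mod m, s mod m) else 0 else 0)"
    using r s by (simp add: tensor_map_def blk)
  also have "\<dots> = (\<Sum>i<k. if r div m = i then E (B i (s div m)) $$ (r mod m, s mod m) else 0)"
    using rs by (intro sum.cong refl) (auto simp: sum.delta')
  also have "\<dots> = block_mat k m (\<lambda>i j. E (B i j)) $$ (r, s)"
    using rs r s by (simp add: sum.delta' block_mat_def)
  finally show "tensor_map k k n m (\<lambda>Z. Z) E (block_mat k n B) $$ (r, s)
      = block_mat k m (\<lambda>i j. E (B i j)) $$ (r, s)" .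
qed (auto simp: tensor_map_def block_mat_def)

text \<open>The block matrix factors as \<open>S * P * S\<^sup>\<dagger>\<close>, where
  \<open>S\<close> stacks the matrices \<open>R i\<close> on top of each other.\<close>

lemma block_mat_sandwich_positive:
  assumes P: "positive_op n P" and R: "\<And>i. i < k \<Longrightarrow> R i \<in> carrier_mat n n"
  shows "positive_op (k * n) (block_mat k n (\<lambda>i j. R i * P * (R j)\<^sup>\<dagger>))"
proof -
  have Pc: "P \<in> carrier_mat n n" using P by (simp add: positive_op_def)
  define S where "S = mat (k * n) n (\<lambda>(r, c). R (r div n) $$ (r mod n, c))"
  have S: "S \<in> carrier_mat (k * n) n" by (simp add: S_def)
  have "block_mat k n (\<lambda>i j. R i * P * (R j)\<^sup>\<dagger>) = S * P * S\<^sup>\<dagger>"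
  proof (rule eq_matI)
    fix r s assume "r < dim_row (S * P * S\<^sup>\<dagger>)" "s < dim_col (S * P * S\<^sup>\<dagger>)"
    then have r: "r < k * n" and s: "s < k * n" using S by auto
    note rs = block_div_mod_less[OF r] block_div_mod_less[OF s]
    have "row (S * P) r = row (R (r div n) * P) (r mod n)"
      using rs r R[OF rs(1)] Pc
      by (intro eq_vecI) (auto simp: S_def scalar_prod_def)
    moreover have "col (S\<^sup>\<dagger>) s = col ((R (s div n))\<^sup>\<dagger>) (s mod n)"
      using rs s R[OF rs(3)] by (intro eq_vecI) (auto simp: S_def)
    ultimately show "block_mat k n (\<lambda>i j. R i * P * (R j)\<^sup>\<dagger>) $$ (r, s) = (S * P * S\<^sup>\<dagger>) $$ (r, s)"
      using r s rs S R[OF rs(1)] R[OF rs(3)] Pc by (simp add: block_mat_def)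
  qed (auto simp: S_def block_mat_def)
  then show ?thesis using positive_op_sandwich[OF P S] by simp
qed

text \<open>For a Stinespring isometry V, the block at \<open>(i, j)\<close> is the environment
  trace of V \<open>R i\<close> \<surd>P times the adjoint of V \<open>R j\<close> \<surd>P. The
  block matrix is thus an operator-valued Gram matrix, and its positivity stands in for computations
  with V and \<surd>P.\<close>

lemma completely_positive_block_mat:
  assumes E: "completely_positive n m E" and P: "positive_op n P"
    and R: "\<And>i. i < k \<Longrightarrow> R i \<in> carrier_mat n n"
  shows "positive_op (k * m) (block_mat k m (\<lambda>i j. E (R i * P * (R j)\<^sup>\<dagger>)))"
proof -
  have "P \<in> carrier_mat n n" using P by (simp add: positive_op_def)
  then have "R i * P * (R j)\<^sup>\<dagger> \<in> carrier_mat n n" if "i < k" "j < k" for i j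
    using R[OF that(1)] R[OF that(2)] by (intro mult_carrier_mat[of _ n n]) auto
  then have "tensor_map k k n m (\<lambda>Z. Z) E (block_mat k n (\<lambda>i j. R i * P * (R j)\<^sup>\<dagger>))
      = block_mat k m (\<lambda>i j. E (R i * P * (R j)\<^sup>\<dagger>))"
    using E by (intro tensor_map_block_mat) (auto simp: completely_positive_def linear_map_def)
  moreover have "positive_op (k * m)
      (tensor_map k k n m (\<lambda>Z. Z) E (block_mat k n (\<lambda>i j. R i * P * (R j)\<^sup>\<dagger>)))"
    using E block_mat_sandwich_positive[OF P R, of k] by (simp add: completely_positive_def)
  ultimately show ?thesis by simp
qed

section \<open>A vanishing criterion and adjoints for completely positive maps\<close>

lemma mat_adjoint_one [simp]: "(1\<^sub>m n :: complex mat)\<^sup>\<dagger> = 1\<^sub>m n"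
  by (rule eq_matI) auto

lemma mat_adjoint_zero [simp]: "(0\<^sub>m n m :: complex mat)\<^sup>\<dagger> = 0\<^sub>m m n"
  by (rule eq_matI) auto

lemma mat_adjoint_uminus: "(- A)\<^sup>\<dagger> = - ((A :: complex mat)\<^sup>\<dagger>)"
  by (rule eq_matI) auto

lemma mat_trace_uminus: "A \<in> carrier_mat n n \<Longrightarrow> mat_trace (- A) = - mat_trace A"
  by (auto simp: mat_trace_def sum_negf)

lemma mat_trace_zero [simp]: "mat_trace (0\<^sub>m n n) = 0"
  by (simp add: mat_trace_def)

lemma completely_positive_carrier:
  "completely_positive n m E \<Longrightarrow> X \<in> carrier_mat n n \<Longrightarrow> E X \<in> carrier_mat m m"
  by (simp add: completely_positive_def linear_map_def)

text \<open>Formally, \<open>null\<close> says that the squared Hilbert-Schmidt norm of Z V \<surd>P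
  - V X \<surd>P is 0, and the conclusion multiplies V R \<surd>P by the adjoint of this difference
  and traces out the environment. The proof uses the Gram matrix of \<open>1\<close>,
  \<open>X\<close> and \<open>R\<close>, whose kernel contains each vector at which its form
  vanishes.\<close>

lemma completely_positive_null:
  assumes E: "completely_positive n m E" and P: "positive_op n P"
    and X: "X \<in> carrier_mat n n" and R: "R \<in> carrier_mat n n" and Z: "Z \<in> carrier_mat m m"
    and null: "mat_trace (Z * (E P * Z\<^sup>\<dagger>)) - mat_trace (Z * E (P * X\<^sup>\<dagger>))
      - mat_trace (E (X * P) * Z\<^sup>\<dagger>) + mat_trace (E (X * P * X\<^sup>\<dagger>)) = 0"
  shows "E (R * P) * Z\<^sup>\<dagger> = E (R * P * X\<^sup>\<dagger>)"
proof -
  have Pc: "P \<in> carrier_mat n n" using P by (simp add: positive_op_def)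
  define S where "S i = (if i = 0 then 1\<^sub>m n else if i = 1 then X else R)" for i :: nat
  \<comment> \<open>Coefficients of the difference above. The weight of the block of
    \<open>R\<close> is 0, so it does not change the value of the form; but its row in the equation
    \<open>?M *\<^sub>v ?v c = 0\<^sub>v (3 * m)\<close> is column \<open>c\<close> of the
    claim.\<close>
  define L where "L i = (if i = 0 then Z\<^sup>\<dagger> else if i = 1 then - 1\<^sub>m m else 0\<^sub>m m m)" for i :: nat
  define B where "B i j = E (S i * P * (S j)\<^sup>\<dagger>)" for i j
  have S: "S i \<in> carrier_mat n n" for i using X R by (auto simp: S_def)
  have L: "L i \<in> carrier_mat m m" for i using Z by (auto simp: L_def)
  have B: "B i j \<in> carrier_mat m m" for i j
    unfolding B_def using S[of i] S[of j] Pc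
    by (intro completely_positive_carrier[OF E] mult_carrier_mat[of _ n n]) auto
  let ?M = "block_mat 3 m B" and ?v = "\<lambda>c. block_vec 3 m (\<lambda>j. col (L j) c)"
  have M: "positive_op (3 * m) ?M"
    unfolding B_def using completely_positive_block_mat[OF E P S] by simp
  have col: "col (L j) c \<in> carrier_vec m" for j c using L[of j] by auto
  have B_simps: "B 0 0 = E P" "B 0 1 = E (P * X\<^sup>\<dagger>)" "B 1 0 = E (X * P)" "B 1 1 = E (X * P * X\<^sup>\<dagger>)"
    "B 2 0 = E (R * P)" "B 2 1 = E (R * P * X\<^sup>\<dagger>)"
    using Pc X R by (simp_all add: B_def S_def)
  note Bc = B[of 0 0, unfolded B_simps] B[of 0 1, unfolded B_simps] B[of 1 0, unfolded B_simps]
    B[of 1 1, unfolded B_simps] B[of 2 0, unfolded B_simps] B[of 2 1, unfolded B_simps]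
  have L_simps: "L 0 = Z\<^sup>\<dagger>" "L 1 = - 1\<^sub>m m" "L 2 = 0\<^sub>m m m" by (simp_all add: L_def)
  have sum3: "(\<Sum>i<3. f i) = f 0 + f 1 + f 2" for f :: "nat \<Rightarrow> complex"
    by (simp add: eval_nat_numeral)
  have "(\<Sum>c<m. (?M *\<^sub>v ?v c) \<bullet>c ?v c)
      = (\<Sum>c<m. \<Sum>i<3. \<Sum>j<3. (B i j *\<^sub>v col (L j) c) \<bullet>c col (L i) c)"
    by (simp add: block_mat_quadratic_form B col)
  also have "\<dots> = (\<Sum>i<3. \<Sum>c<m. \<Sum>j<3. (B i j *\<^sub>v col (L j) c) \<bullet>c col (L i) c)"
    by (rule sum.swap)
  also have "\<dots> = (\<Sum>i<3. \<Sum>j<3. \<Sum>c<m. (B i j *\<^sub>v col (L j) c) \<bullet>c col (L i) c)"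
    by (intro sum.cong refl sum.swap)
  also have "\<dots> = (\<Sum>i<3. \<Sum>j<3. mat_trace ((L i)\<^sup>\<dagger> * (B i j * L j)))"
    by (simp add: mat_trace_sandwich[OF B L L])
  also have "\<dots> = 0"
  proof -
    have 2: "mat_trace ((L i)\<^sup>\<dagger> * (B i 2 * L 2)) = 0" "mat_trace ((L 2)\<^sup>\<dagger> * (B 2 i * L i)) = 0" for i
      using B[of i 2] B[of 2 i] L[of i] by (simp_all add: L_simps)
    have 00: "(L 0)\<^sup>\<dagger> * (B 0 0 * L 0) = Z * (E P * Z\<^sup>\<dagger>)" by (simp add: L_simps B_simps)
    have 01: "(L 0)\<^sup>\<dagger> * (B 0 1 * L 1) = - (Z * E (P * X\<^sup>\<dagger>))"
      unfolding L_simps B_simps using Z Bc by simp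
    have 10: "(L 1)\<^sup>\<dagger> * (B 1 0 * L 0) = - (E (X * P) * Z\<^sup>\<dagger>)"
      unfolding L_simps B_simps mat_adjoint_uminus using Z Bc by simp
    have 11: "(L 1)\<^sup>\<dagger> * (B 1 1 * L 1) = E (X * P * X\<^sup>\<dagger>)"
      unfolding L_simps B_simps mat_adjoint_uminus using Z Bc by simp
    have "mat_trace (- (Z * E (P * X\<^sup>\<dagger>))) = - mat_trace (Z * E (P * X\<^sup>\<dagger>))"
      "mat_trace (- (E (X * P) * Z\<^sup>\<dagger>)) = - mat_trace (E (X * P) * Z\<^sup>\<dagger>)"
      by (rule mat_trace_uminus[of _ m], use Z Bc in auto)+
    then show ?thesis using null unfolding sum3 2 00 01 10 11 by (simp add: algebra_simps)
  qed
  finally have "(\<Sum>c<m. (?M *\<^sub>v ?v c) \<bullet>c ?v c) = 0" .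
  moreover have "0 \<le> (?M *\<^sub>v ?v c) \<bullet>c ?v c" for c
    using M by (auto simp: positive_op_def)
  ultimately have "(?M *\<^sub>v ?v c) \<bullet>c ?v c = 0" if "c < m" for c
    using that sum_nonneg_eq_0_iff[of "{..<m}" "\<lambda>c. (?M *\<^sub>v ?v c) \<bullet>c ?v c"] by auto
  then have Mv: "?M *\<^sub>v ?v c = 0\<^sub>v (3 * m)" if "c < m" for c
    using that by (intro positive_op_null[OF M]) auto
  show ?thesis
  proof (rule eq_matI)
    fix a c assume "a < dim_row (E (R * P * X\<^sup>\<dagger>))" "c < dim_col (E (R * P * X\<^sup>\<dagger>))"
    then have a: "a < m" and c: "c < m" using Bc by auto
    have "2 * m + a < 3 * m" using a by simp
    then have "0 = (?M *\<^sub>v ?v c) $ (2 * m + a)" using Mv[OF c] a by simp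
    also have "\<dots> = (\<Sum>j<3. (B 2 j *\<^sub>v col (L j) c) $ a)"
      using a by (intro block_mat_mult_vec_index B col) auto
    also have "\<dots> = (E (R * P) * Z\<^sup>\<dagger>) $$ (a, c) - E (R * P * X\<^sup>\<dagger>) $$ (a, c)"
    proof -
      have "(B 2 j *\<^sub>v col (L j) c) $ a = (B 2 j * L j) $$ (a, c)" for j
        using a c B[of 2 j] L[of j] by auto
      then show ?thesis unfolding sum3 L_simps B_simps using a c Z Bc B[of 2 2] by simp
    qed
    finally show "(E (R * P) * Z\<^sup>\<dagger>) $$ (a, c) = E (R * P * X\<^sup>\<dagger>) $$ (a, c)" by simp
  qed (use Z Bc in auto)
qed

lemma positive_op_one: "positive_op n (1\<^sub>m n)"
  unfolding positive_op_def
  by (auto simp: conjugate_square_ge_0_vec)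

text \<open>The Gram matrix of \<open>1\<close> and \<open>M\<close> with respect to the identity is
  positive, hence hermitian, and its off-diagonal blocks are \<open>E (M\<^sup>\<dagger>)\<close>
  and \<open>E M\<close>.\<close>

lemma completely_positive_adjoint:
  assumes E: "completely_positive n m E" and M: "M \<in> carrier_mat n n"
  shows "E (M\<^sup>\<dagger>) = (E M)\<^sup>\<dagger>"
proof -
  define S where "S i = (if i = 0 then 1\<^sub>m n else M)" for i :: nat
  define B where "B i j = E (S i * 1\<^sub>m n * (S j)\<^sup>\<dagger>)" for i j
  have S: "S i \<in> carrier_mat n n" for i using M by (auto simp: S_def)
  have B: "B i j \<in> carrier_mat m m" for i j
    unfolding B_def using S[of i] S[of j]
    by (intro completely_positive_carrier[OF E] mult_carrier_mat[of _ n n]) auto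
  have "(block_mat 2 m B)\<^sup>\<dagger> = block_mat 2 m B"
    unfolding B_def
    using completely_positive_block_mat[OF E positive_op_one S] by (intro positive_op_hermitian[of "2 * m"]) simp
  then have *: "(block_mat 2 m B)\<^sup>\<dagger> $$ (0 * m + a, 1 * m + b) = block_mat 2 m B $$ (0 * m + a, 1 * m + b)" for a b
    by simp
  have entry: "block_mat 2 m B $$ (i * m + a, j * m + b) = B i j $$ (a, b)"
    if "i < 2" "j < 2" "a < m" "b < m" for i j a b
    using that by (simp add: block_mat_def block_index_less)
  have "B 0 1 = (B 1 0)\<^sup>\<dagger>"
  proof (rule eq_matI)
    fix a b assume "a < dim_row ((B 1 0)\<^sup>\<dagger>)" "b < dim_col ((B 1 0)\<^sup>\<dagger>)"
    then have ab: "a < m" "b < m" using B[of 1 0] by auto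
    have "(block_mat 2 m B)\<^sup>\<dagger> $$ (0 * m + a, 1 * m + b) = cnj (block_mat 2 m B $$ (1 * m + b, 0 * m + a))"
      using ab by (intro mat_adjoint_index) (auto simp: block_mat_def)
    then show "B 0 1 $$ (a, b) = (B 1 0)\<^sup>\<dagger> $$ (a, b)"
      using *[of a b] ab B[of 1 0] by (simp only: entry) auto
  qed (use B[of 0 1] B[of 1 0] in auto)
  then show ?thesis using M by (simp add: B_def S_def)
qed

subsection \<open>Tensor products and partial traces\<close>

lemma kron_mat_carrier [simp]:
  "A \<in> carrier_mat n n \<Longrightarrow> B \<in> carrier_mat m m \<Longrightarrow> kron_mat A B \<in> carrier_mat (n * m) (n * m)"
  by (auto simp: kron_mat_def)

lemma kron_mat_index:
  assumes "A \<in> carrier_mat n n" "B \<in> carrier_mat m m" "r < n * m" "s < n * m"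
  shows "kron_mat A B $$ (r, s) = A $$ (r div m, s div m) * B $$ (r mod m, s mod m)"
  using assms by (auto simp: kron_mat_def)

lemma kron_mat_mult:
  assumes "A \<in> carrier_mat n n" "B \<in> carrier_mat m m" "C \<in> carrier_mat n n" "D \<in> carrier_mat m m"
  shows "kron_mat A B * kron_mat C D = kron_mat (A * C) (B * D)"
proof (rule eq_matI)
  fix r s assume "r < dim_row (kron_mat (A * C) (B * D))" "s < dim_col (kron_mat (A * C) (B * D))"
  then have r: "r < n * m" and s: "s < n * m" using assms by (auto simp: kron_mat_def)
  note rs = block_div_mod_less[OF r] block_div_mod_less[OF s]
  have AC: "A * C \<in> carrier_mat n n" and BD: "B * D \<in> carrier_mat m m" using assms by auto
  have "(kron_mat A B * kron_mat C D) $$ (r, s)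
      = (\<Sum>t<n * m. kron_mat A B $$ (r, t) * kron_mat C D $$ (t, s))"
    using r s kron_mat_carrier[OF assms(1,2)] kron_mat_carrier[OF assms(3,4)]
    by (auto simp: scalar_prod_def lessThan_atLeast0)
  also have "\<dots> = (\<Sum>i<n. \<Sum>a<m. (A $$ (r div m, i) * C $$ (i, s div m))
      * (B $$ (r mod m, a) * D $$ (a, s mod m)))"
    unfolding sum_blocks using r s assms
    by (intro sum.cong refl) (simp add: kron_mat_index[of _ n _ m] block_index_less)
  also have "\<dots> = (\<Sum>i<n. A $$ (r div m, i) * C $$ (i, s div m))
      * (\<Sum>a<m. B $$ (r mod m, a) * D $$ (a, s mod m))"
    by (simp add: sum_product)
  also have "\<dots> = (A * C) $$ (r div m, s div m) * (B * D) $$ (r mod m, s mod m)"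
    using rs assms by (auto simp: scalar_prod_def lessThan_atLeast0)
  finally show "(kron_mat A B * kron_mat C D) $$ (r, s) = kron_mat (A * C) (B * D) $$ (r, s)"
    using kron_mat_index[OF AC BD r s] by simp
qed (use assms in \<open>auto simp: kron_mat_def\<close>)

lemma kron_mat_adjoint:
  assumes "A \<in> carrier_mat n n" "B \<in> carrier_mat m m"
  shows "(kron_mat A B)\<^sup>\<dagger> = kron_mat (A\<^sup>\<dagger>) (B\<^sup>\<dagger>)"
proof (rule eq_matI)
  fix r s assume "r < dim_row (kron_mat (A\<^sup>\<dagger>) (B\<^sup>\<dagger>))" "s < dim_col (kron_mat (A\<^sup>\<dagger>) (B\<^sup>\<dagger>))"
  then have r: "r < n * m" and s: "s < n * m" using assms by (auto simp: kron_mat_def)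
  note rs = block_div_mod_less[OF r] block_div_mod_less[OF s]
  show "(kron_mat A B)\<^sup>\<dagger> $$ (r, s) = kron_mat (A\<^sup>\<dagger>) (B\<^sup>\<dagger>) $$ (r, s)"
    using r s rs assms
    by (simp add: kron_mat_index[of _ n _ m] carrier_matD[OF kron_mat_carrier[OF assms]])
qed (use assms in \<open>auto simp: kron_mat_def\<close>)

text \<open>Duality of the partial trace with \<open>Z\<close> \<mapsto>
  \<open>kron_mat Z (1\<^sub>m m)\<close>. It turns the broadcasting condition into an equality of
  expectation values.\<close>

lemma mat_trace_ptrace_snd:
  assumes W: "W \<in> carrier_mat (n * m) (n * m)" and Z: "Z \<in> carrier_mat n n"
  shows "mat_trace (W * kron_mat Z (1\<^sub>m m)) = mat_trace (ptrace_snd n m W * Z)"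
proof -
  have K: "kron_mat Z (1\<^sub>m m) \<in> carrier_mat (n * m) (n * m)" using Z by simp
  have p: "ptrace_snd n m W \<in> carrier_mat n n" by (simp add: ptrace_snd_def)
  have "mat_trace (W * kron_mat Z (1\<^sub>m m))
      = (\<Sum>i<n. \<Sum>a<m. \<Sum>j<n. \<Sum>b<m. if b = a then W $$ (i * m + a, j * m + b) * Z $$ (j, i) else 0)"
    unfolding mat_trace_mult[OF W K] sum_blocks using Z
    by (intro sum.cong refl) (simp add: kron_mat_index[of _ n _ m] block_index_less)
  also have "\<dots> = (\<Sum>i<n. \<Sum>a<m. \<Sum>j<n. W $$ (i * m + a, j * m + a) * Z $$ (j, i))"
    by (intro sum.cong refl) simp
  also have "\<dots> = (\<Sum>i<n. \<Sum>j<n. \<Sum>a<m. W $$ (i * m + a, j * m + a) * Z $$ (j, i))"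
    by (intro sum.cong refl sum.swap)
  also have "\<dots> = mat_trace (ptrace_snd n m W * Z)"
    unfolding mat_trace_mult[OF p Z] by (simp add: ptrace_snd_def sum_distrib_right)
  finally show ?thesis .
qed

lemma mat_trace_ptrace_fst:
  assumes W: "W \<in> carrier_mat (n * m) (n * m)" and Z: "Z \<in> carrier_mat m m"
  shows "mat_trace (W * kron_mat (1\<^sub>m n) Z) = mat_trace (ptrace_fst n m W * Z)"
proof -
  have K: "kron_mat (1\<^sub>m n) Z \<in> carrier_mat (n * m) (n * m)" using Z by simp
  have p: "ptrace_fst n m W \<in> carrier_mat m m" by (simp add: ptrace_fst_def)
  have "mat_trace (W * kron_mat (1\<^sub>m n) Z)
      = (\<Sum>i<n. \<Sum>a<m. \<Sum>j<n. if j = i then \<Sum>b<m. W $$ (i * m + a, j * m + b) * Z $$ (b, a) else 0)"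
    unfolding mat_trace_mult[OF W K] sum_blocks using Z
    by (intro sum.cong refl) (simp add: kron_mat_index[of _ n _ m] block_index_less)
  also have "\<dots> = (\<Sum>i<n. \<Sum>a<m. \<Sum>b<m. W $$ (i * m + a, i * m + b) * Z $$ (b, a))"
    by (rule sum.cong[OF refl], rule sum.cong[OF refl]) simp
  also have "\<dots> = (\<Sum>a<m. \<Sum>i<n. \<Sum>b<m. W $$ (i * m + a, i * m + b) * Z $$ (b, a))"
    by (rule sum.swap)
  also have "\<dots> = (\<Sum>a<m. \<Sum>b<m. \<Sum>i<n. W $$ (i * m + a, i * m + b) * Z $$ (b, a))"
    by (intro sum.cong refl sum.swap)
  also have "\<dots> = mat_trace (ptrace_fst n m W * Z)"
    unfolding mat_trace_mult[OF p Z] by (simp add: ptrace_fst_def sum_distrib_right)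
  finally show ?thesis .
qed

section \<open>Nonnegative traces and division by a hermitian matrix\<close>

lemma positive_op_trace_nonneg:
  assumes P: "positive_op n P" and Y: "Y \<in> carrier_mat n n"
  shows "0 \<le> mat_trace (Y\<^sup>\<dagger> * (P * Y))"
proof -
  have Pc: "P \<in> carrier_mat n n" using P by (simp add: positive_op_def)
  show ?thesis
    unfolding mat_trace_sandwich[OF Pc Y Y] using P Y by (intro sum_nonneg) (auto simp: positive_op_def)
qed

lemma mat_adjoint_mult_self_eq_0:
  fixes M :: "complex mat"
  assumes M: "M \<in> carrier_mat n n" and "M\<^sup>\<dagger> * M = 0\<^sub>m n n"
  shows "M = 0\<^sub>m n n"
  using positive_op_trace_null[OF positive_op_one M] assms by simp

text \<open>The quotient comes from a generalized inverse \<open>H\<close> of \<open>P * P\<close>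
  instead of \<open>P\<close>: this gives \<open>X\<close> a left factor \<open>P\<close>, which
  provides the second equation \<open>X * P = P * R\<close>.\<close>

lemma hermitian_left_division:
  fixes A P :: "complex mat"
  assumes P: "P \<in> carrier_mat n n" "P\<^sup>\<dagger> = P" and A: "A \<in> carrier_mat n n" "A\<^sup>\<dagger> = A"
    and ker: "\<And>N. N \<in> carrier_mat n n \<Longrightarrow> P * N = 0\<^sub>m n n \<Longrightarrow> A * N = 0\<^sub>m n n"
  obtains X R where "X \<in> carrier_mat n n" "R \<in> carrier_mat n n" "P * X = A" "X * P = P * R"
proof -
  note assoc = assoc_mult_mat[of _ n n _ n _ n]
  have PP: "P * P \<in> carrier_mat n n" using P by auto
  obtain H where H: "H \<in> carrier_mat n n" and inv: "(P * P) * H * (P * P) = P * P"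
    using generalized_inverse[OF PP] .
  define N where "N = 1\<^sub>m n - H * (P * P)"
  have HPP: "H * (P * P) \<in> carrier_mat n n" using H PP by auto
  have N: "N \<in> carrier_mat n n" using HPP by (auto simp: N_def intro: minus_carrier_mat)
  have "(P * P) * N = 0\<^sub>m n n"
    using inv PP HPP H P by (simp add: N_def mult_minus_distrib_mat[of _ n n _ n] assoc)
  then have "P * (P * N) = 0\<^sub>m n n" by (simp only: assoc[OF P(1) P(1) N])
  \<comment> \<open>As \<open>P\<close> is hermitian, \<open>P * P\<close> and \<open>P\<close> have
    the same kernel. So \<open>ker\<close> applies to \<open>N\<close>, and the adjoint of
    \<open>A = A * (H * (P * P))\<close> exhibits the quotient.\<close>
  then have "(P * N)\<^sup>\<dagger> * (P * N) = 0\<^sub>m n n"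
    using N P assoc[of "N\<^sup>\<dagger>" P "P * N"] by (simp add: mat_adjoint_mult[OF P(1) N])
  then have "P * N = 0\<^sub>m n n" by (rule mat_adjoint_mult_self_eq_0[OF mult_carrier_mat[OF P(1) N]])
  then have "A - A * (H * (P * P)) = 0\<^sub>m n n"
    using ker[OF N] A HPP by (simp add: N_def mult_minus_distrib_mat[of _ n n _ n])
  moreover have "A * (H * (P * P)) \<in> carrier_mat n n" using A HPP by auto
  ultimately have "A = A * (H * (P * P))"
    using A(1) by (intro eq_matI) (auto simp: mat_eq_iff)
  then have "A\<^sup>\<dagger> = (A * (H * (P * P)))\<^sup>\<dagger>" by simp
  also have "\<dots> = P * (P * (H\<^sup>\<dagger> * A))"
    using A P H PP HPP by (simp add: mat_adjoint_mult[of _ n n _ n] assoc)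
  finally have "P * (P * (H\<^sup>\<dagger> * A)) = A" using A by simp
  moreover have "P * (H\<^sup>\<dagger> * A) * P = P * (H\<^sup>\<dagger> * A * P)"
    using P A H by (intro assoc) auto
  ultimately show thesis
    using P A H by (intro that[of "P * (H\<^sup>\<dagger> * A)" "H\<^sup>\<dagger> * A * P"]) auto
qed

subsection \<open>Broadcasting\<close>

text \<open>
  Below \<open>J\<close> embeds the observables of one receiver in those of the whole output, as
  \<open>Z \<mapsto> Z \<otimes> 1\<close> or \<open>Z \<mapsto> 1 \<otimes> Z\<close>. With a Stinespring isometry \<open>V\<close> of \<open>E\<close>, the two conclusions
  say \<open>(J X)\<^sup>\<dagger> V \<surd>P = V X\<^sup>\<dagger> \<surd>P\<close> and \<open>J X V \<surd>P = V X \<surd>P\<close>.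
\<close>

lemma broadcast_intertwining:
  fixes J :: "complex mat \<Rightarrow> complex mat"
  assumes E: "completely_positive n m E" and tp: "trace_preserving n E"
    and P: "positive_op n P" and A: "A \<in> carrier_mat n n" "A\<^sup>\<dagger> = A"
    and X: "X \<in> carrier_mat n n" and R: "R \<in> carrier_mat n n"
    and PX: "P * X = A" and XP: "X * P = P * R"
    and J: "\<And>Z. Z \<in> carrier_mat n n \<Longrightarrow> J Z \<in> carrier_mat m m"
    and J_mult: "\<And>Y Z. Y \<in> carrier_mat n n \<Longrightarrow> Z \<in> carrier_mat n n \<Longrightarrow> J Y * J Z = J (Y * Z)"
    and J_adj: "\<And>Z. Z \<in> carrier_mat n n \<Longrightarrow> (J Z)\<^sup>\<dagger> = J (Z\<^sup>\<dagger>)"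
    and JP: "\<And>Z. Z \<in> carrier_mat n n \<Longrightarrow> mat_trace (E P * J Z) = mat_trace (P * Z)"
    and JA: "\<And>Z. Z \<in> carrier_mat n n \<Longrightarrow> mat_trace (E A * J Z) = mat_trace (A * Z)"
  shows "E P * J X = E A" "E P * J (X\<^sup>\<dagger>) = E (P * X\<^sup>\<dagger>)"
proof -
  note assoc = assoc_mult_mat[of _ n n _ n _ n] and assoc' = assoc_mult_mat[of _ m m _ m _ m]
  have Pc: "P \<in> carrier_mat n n" using P by (simp add: positive_op_def)
  have Ph: "P\<^sup>\<dagger> = P" using positive_op_hermitian[OF P] .
  have X': "X\<^sup>\<dagger> \<in> carrier_mat n n" using X by simp
  have R': "R\<^sup>\<dagger> \<in> carrier_mat n n" using R by simp
  note Ec = completely_positive_carrier[OF E]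
  have tr: "mat_trace (E M) = mat_trace M" if "M \<in> carrier_mat n n" for M
    using tp that by (simp add: trace_preserving_def)
  have XA: "X\<^sup>\<dagger> * P = A"
    using mat_adjoint_mult[OF Pc X] A PX Ph by simp
  have comm: "mat_trace (Y * Z) = mat_trace (Z * Y)" if "Y \<in> carrier_mat m m" "Z \<in> carrier_mat m m" for Y Z
    using that by (rule mat_trace_comm)
  have comm_n: "mat_trace (Y * Z) = mat_trace (Z * Y)" if "Y \<in> carrier_mat n n" "Z \<in> carrier_mat n n" for Y Z
    using that by (rule mat_trace_comm)
  \<comment> \<open>The criterion \<open>completely_positive_null\<close> for
    \<open>X\<^sup>\<dagger>\<close> and \<open>J (X\<^sup>\<dagger>)\<close>: fact \<open>1\<close>
    cancels the first two of its traces, fact \<open>2\<close> the last two. The left factor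
    \<open>S\<close> stays free because it is taken to be both \<open>1\<^sub>m n\<close> and
    \<open>R\<^sup>\<dagger>\<close> below.\<close>
  have first: "E (S * P) * J X = E (S * P * X)" if S: "S \<in> carrier_mat n n" for S
  proof -
    have "mat_trace (J (X\<^sup>\<dagger>) * (E P * J X)) = mat_trace (E P * J (X * X\<^sup>\<dagger>))"
      using comm[of "J (X\<^sup>\<dagger>)" "E P * J X"] J[OF X] J[OF X'] Ec[OF Pc] by (simp add: assoc' J_mult[OF X X'])
    also have "\<dots> = mat_trace (A * X\<^sup>\<dagger>)"
      using X X' Pc by (simp add: JP PX[symmetric] assoc)
    also have "\<dots> = mat_trace (J (X\<^sup>\<dagger>) * E (P * X))"
      using comm[of "J (X\<^sup>\<dagger>)" "E A"] J[OF X'] Ec[OF A(1)] X' by (simp add: JA PX)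
    finally have 1: "mat_trace (J (X\<^sup>\<dagger>) * (E P * J X)) = mat_trace (J (X\<^sup>\<dagger>) * E (P * X))" .
    have 2: "mat_trace (E (X\<^sup>\<dagger> * P) * J X) = mat_trace (E (X\<^sup>\<dagger> * P * X))"
      using A X by (simp add: XA JA tr)
    have "E (S * P) * (J (X\<^sup>\<dagger>))\<^sup>\<dagger> = E (S * P * (X\<^sup>\<dagger>)\<^sup>\<dagger>)"
      by (rule completely_positive_null[OF E P X' S J[OF X']])
        (simp add: J_adj[OF X'] 1 2)
    then show ?thesis using J_adj[OF X'] by simp
  qed
  show "E P * J X = E A"
    using first[of "1\<^sub>m n"] Pc PX by simp
  \<comment> \<open>This moves the factor \<open>X\<^sup>\<dagger>\<close> to the left of
    \<open>P\<close> in the guise of \<open>R\<^sup>\<dagger>\<close>, so that \<open>first\<close>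
    evaluates the mixed trace with \<open>E (P * X\<^sup>\<dagger>)\<close>.\<close>
  have PX': "P * X\<^sup>\<dagger> = R\<^sup>\<dagger> * P"
    using arg_cong[OF XP, of mat_adjoint] X Pc R Ph by (simp add: mat_adjoint_mult[of _ n n _ n])
  have PXX: "P * (X\<^sup>\<dagger> * X) = R\<^sup>\<dagger> * P * X"
    using PX' X X' Pc by (simp add: assoc[symmetric])
  have XX: "X\<^sup>\<dagger> * X \<in> carrier_mat n n" and PXXc: "P * (X\<^sup>\<dagger> * X) \<in> carrier_mat n n"
    and PX'c: "P * X\<^sup>\<dagger> \<in> carrier_mat n n" and XPc: "X * P \<in> carrier_mat n n"
    using X X' Pc by auto
  have "mat_trace (J X * (E P * J (X\<^sup>\<dagger>))) = mat_trace (E P * J (X\<^sup>\<dagger> * X))"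
    using comm[of "J X" "E P * J (X\<^sup>\<dagger>)"] J[OF X] J[OF X'] Ec[OF Pc] by (simp add: assoc' J_mult[OF X' X])
  also have "\<dots> = mat_trace (P * (X\<^sup>\<dagger> * X))" using XX by (rule JP)
  finally have 1: "mat_trace (J X * (E P * J (X\<^sup>\<dagger>))) = mat_trace (P * (X\<^sup>\<dagger> * X))" .
  have "mat_trace (J X * E (P * X\<^sup>\<dagger>)) = mat_trace (E (R\<^sup>\<dagger> * P) * J X)"
    using comm[of "J X" "E (P * X\<^sup>\<dagger>)"] J[OF X] Ec[OF PX'c] by (simp add: PX')
  also have "\<dots> = mat_trace (E (P * (X\<^sup>\<dagger> * X)))"
    using first[OF R'] PXX by simp
  also have "\<dots> = mat_trace (P * (X\<^sup>\<dagger> * X))" using PXXc by (rule tr)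
  finally have 2: "mat_trace (J X * E (P * X\<^sup>\<dagger>)) = mat_trace (P * (X\<^sup>\<dagger> * X))" .
  \<comment> \<open>The other mixed trace is the conjugate of the one in \<open>2\<close>, because
    the operators are adjoint to each other. Cyclicity identifies it with the last trace of the
    criterion.\<close>
  have "E (X * P) = (E (P * X\<^sup>\<dagger>))\<^sup>\<dagger>"
    using completely_positive_adjoint[OF E PX'c] mat_adjoint_mult[OF Pc X'] Ph by simp
  then have "E (X * P) * J (X\<^sup>\<dagger>) = (J X * E (P * X\<^sup>\<dagger>))\<^sup>\<dagger>"
    using mat_adjoint_mult[OF J[OF X] Ec[OF PX'c]] J_adj[OF X] by simp
  then have "mat_trace (E (X * P) * J (X\<^sup>\<dagger>)) = cnj (mat_trace (P * (X\<^sup>\<dagger> * X)))"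
    using mat_trace_adjoint[of "J X * E (P * X\<^sup>\<dagger>)" m] J[OF X] Ec[OF PX'c] 2 by simp
  also have "\<dots> = mat_trace ((X\<^sup>\<dagger> * X) * P)"
    using mat_trace_adjoint[OF PXXc] mat_adjoint_mult[OF Pc XX] mat_adjoint_mult[OF X' X] Ph by simp
  also have "\<dots> = mat_trace (X * P * X\<^sup>\<dagger>)"
    using comm_n[of "X\<^sup>\<dagger>" "X * P"] X X' Pc by (simp add: assoc)
  also have "\<dots> = mat_trace (E (X * P * X\<^sup>\<dagger>))"
    using XPc X' by (subst tr) auto
  finally have 3: "mat_trace (E (X * P) * J (X\<^sup>\<dagger>)) = mat_trace (E (X * P * X\<^sup>\<dagger>))" .
  have "E (1\<^sub>m n * P) * (J X)\<^sup>\<dagger> = E (1\<^sub>m n * P * X\<^sup>\<dagger>)"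
    by (rule completely_positive_null[OF E P X _ J[OF X]]) (simp_all add: J_adj[OF X] 1 2 3)
  then show "E P * J (X\<^sup>\<dagger>) = E (P * X\<^sup>\<dagger>)" using Pc J_adj[OF X] by simp
qed

text \<open>The assumption \<open>ker\<close> says that the support of \<open>A\<close> lies in that
  of \<open>P\<close>, which is what permits the division of \<open>A\<close> by
  \<open>P\<close>.\<close>

lemma broadcasting_commute:
  assumes E: "completely_positive n (n * n) E" and tp: "trace_preserving n E"
    and P: "positive_op n P" and A: "positive_op n A"
    and ker: "\<And>N. N \<in> carrier_mat n n \<Longrightarrow> P * N = 0\<^sub>m n n \<Longrightarrow> A * N = 0\<^sub>m n n"
    and bP: "broadcasting n E P" and bA: "broadcasting n E A"
  shows "A * P = P * A"
proof -
  note assoc = assoc_mult_mat[of _ n n _ n _ n]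
    and assoc' = assoc_mult_mat[of _ "n * n" "n * n" _ "n * n" _ "n * n"]
  have Pc: "P \<in> carrier_mat n n" and Ac: "A \<in> carrier_mat n n" using P A by (auto simp: positive_op_def)
  have Ph: "P\<^sup>\<dagger> = P" and Ah: "A\<^sup>\<dagger> = A" using P A by (auto intro: positive_op_hermitian)
  obtain X R where X: "X \<in> carrier_mat n n" and R: "R \<in> carrier_mat n n"
    and PX: "P * X = A" and XP: "X * P = P * R"
    using hermitian_left_division[OF Pc Ph Ac Ah ker] .
  have X': "X\<^sup>\<dagger> \<in> carrier_mat n n" using X by simp
  note Ec = completely_positive_carrier[OF E]
  define J1 J2 where "J1 Z = kron_mat Z (1\<^sub>m n)" and "J2 Z = kron_mat (1\<^sub>m n) Z" for Z :: "complex mat"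
  have J1: "J1 Z \<in> carrier_mat (n * n) (n * n)" and J2: "J2 Z \<in> carrier_mat (n * n) (n * n)"
    if "Z \<in> carrier_mat n n" for Z using that by (auto simp: J1_def J2_def)
  have J1_mult: "J1 Y * J1 Z = J1 (Y * Z)" and J2_mult: "J2 Y * J2 Z = J2 (Y * Z)"
    and J_comm: "J1 Y * J2 Z = J2 Z * J1 Y"
    if "Y \<in> carrier_mat n n" "Z \<in> carrier_mat n n" for Y Z
    using that by (simp_all add: J1_def J2_def kron_mat_mult[of _ n _ n])
  have J1_adj: "(J1 Z)\<^sup>\<dagger> = J1 (Z\<^sup>\<dagger>)" and J2_adj: "(J2 Z)\<^sup>\<dagger> = J2 (Z\<^sup>\<dagger>)"
    if "Z \<in> carrier_mat n n" for Z
    using that by (simp_all add: J1_def J2_def kron_mat_adjoint[of _ n _ n])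
  have tr1: "mat_trace (E M * J1 Z) = mat_trace (M * Z)"
    and tr2: "mat_trace (E M * J2 Z) = mat_trace (M * Z)"
    if "M \<in> carrier_mat n n" "broadcasting n E M" "Z \<in> carrier_mat n n" for M Z
    using mat_trace_ptrace_snd[OF Ec[OF that(1)] that(3)] mat_trace_ptrace_fst[OF Ec[OF that(1)] that(3)] that(2)
    by (simp_all add: broadcasting_def J1_def J2_def)
  note i1 = broadcast_intertwining[OF E tp P Ac Ah X R PX XP J1 J1_mult J1_adj tr1[OF Pc bP] tr1[OF Ac bA]]
    and i2 = broadcast_intertwining[OF E tp P Ac Ah X R PX XP J2 J2_mult J2_adj tr2[OF Pc bP] tr2[OF Ac bA]]
  note c = Ec[OF Pc] J1[OF X] J1[OF X'] J2[OF X] J2[OF X']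
  \<comment> \<open>The receivers are exchanged one factor at a time: \<open>J1 X\<close> and
    \<open>J2 X\<close> agree after \<open>E P\<close>, and so do
    \<open>J1 (X\<^sup>\<dagger>)\<close> and \<open>J2 (X\<^sup>\<dagger>)\<close>. The commutation
    in between reverses the order of \<open>X\<close> and \<open>X\<^sup>\<dagger>\<close>.\<close>
  have "mat_trace (P * (X * X\<^sup>\<dagger>)) = mat_trace (E P * J2 (X * X\<^sup>\<dagger>))"
    using X by (subst tr2[OF Pc bP]) auto
  also have "E P * J2 (X * X\<^sup>\<dagger>) = E P * J2 X * J2 (X\<^sup>\<dagger>)"
    using c by (simp add: assoc' J2_mult[OF X X'])
  also have "\<dots> = E P * J1 X * J2 (X\<^sup>\<dagger>)"
    by (simp add: i1 i2)
  also have "\<dots> = E P * J2 (X\<^sup>\<dagger>) * J1 X"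
    using c by (simp add: assoc' J_comm[OF X X'])
  also have "\<dots> = E P * J1 (X\<^sup>\<dagger>) * J1 X"
    by (simp add: i1 i2)
  also have "\<dots> = E P * J1 (X\<^sup>\<dagger> * X)"
    using c by (simp add: assoc' J1_mult[OF X' X])
  also have "mat_trace \<dots> = mat_trace (P * (X\<^sup>\<dagger> * X))"
    using X by (subst tr1[OF Pc bP]) auto
  finally have normal: "mat_trace (P * (X * X\<^sup>\<dagger>)) = mat_trace (P * (X\<^sup>\<dagger> * X))" .
  define Y where "Y = X - X\<^sup>\<dagger>"
  have Y: "Y \<in> carrier_mat n n" using X X' by (auto simp: Y_def intro: minus_carrier_mat)
  have Y': "Y\<^sup>\<dagger> = X\<^sup>\<dagger> - X" using mat_adjoint_minus[OF X X'] by (simp add: Y_def)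
  have PX': "P * X\<^sup>\<dagger> \<in> carrier_mat n n" using Pc X' by simp
  have PY: "P * Y = A - P * X\<^sup>\<dagger>"
    using mult_minus_distrib_mat[OF Pc X X'] PX by (simp add: Y_def)
  have XA: "X\<^sup>\<dagger> * P = A" using mat_adjoint_mult[OF Pc X] Ah PX Ph by simp
  \<comment> \<open>The four terms in the expansion of
    \<open>mat_trace (Y\<^sup>\<dagger> * (P * Y))\<close>. The first three equal one side of
    \<open>normal\<close> and the fourth equals the other, and the signs make them cancel.\<close>
  have t1: "mat_trace (X\<^sup>\<dagger> * A) = mat_trace (P * (X * X\<^sup>\<dagger>))"
    using mat_trace_comm[OF X' Ac] Pc X X' by (simp add: PX[symmetric] assoc)
  have "X\<^sup>\<dagger> * (P * X\<^sup>\<dagger>) = A * X\<^sup>\<dagger>" using X' Pc by (simp add: assoc[symmetric] XA)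
  then have t2: "mat_trace (X\<^sup>\<dagger> * (P * X\<^sup>\<dagger>)) = mat_trace (P * (X * X\<^sup>\<dagger>))"
    using Pc X X' by (simp add: PX[symmetric] assoc)
  have "X\<^sup>\<dagger> * A = A * X" using X X' Pc XA PX by (metis assoc)
  then have t3: "mat_trace (X * A) = mat_trace (P * (X * X\<^sup>\<dagger>))"
    using mat_trace_comm[OF X Ac] t1 by simp
  have t4: "mat_trace (X * (P * X\<^sup>\<dagger>)) = mat_trace (P * (X\<^sup>\<dagger> * X))"
    using mat_trace_comm[OF X PX'] Pc X X' by (simp add: assoc)
  have "Y\<^sup>\<dagger> * (P * Y) = (X\<^sup>\<dagger> * A - X\<^sup>\<dagger> * (P * X\<^sup>\<dagger>)) - (X * A - X * (P * X\<^sup>\<dagger>))"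
  proof -
    have "Y\<^sup>\<dagger> * (P * Y) = X\<^sup>\<dagger> * (A - P * X\<^sup>\<dagger>) - X * (A - P * X\<^sup>\<dagger>)"
      unfolding Y' PY using X X' Ac PX' by (intro minus_mult_distrib_mat) (auto intro: minus_carrier_mat)
    then show ?thesis
      by (simp only: mult_minus_distrib_mat[OF X' Ac PX'] mult_minus_distrib_mat[OF X Ac PX'])
  qed
  moreover have "X\<^sup>\<dagger> * A \<in> carrier_mat n n" "X\<^sup>\<dagger> * (P * X\<^sup>\<dagger>) \<in> carrier_mat n n"
    "X * A \<in> carrier_mat n n" "X * (P * X\<^sup>\<dagger>) \<in> carrier_mat n n" using X X' Ac Pc by auto
  ultimately have "mat_trace (Y\<^sup>\<dagger> * (P * Y)) = 0"
    by (simp add: mat_trace_minus[of _ n] minus_carrier_mat t1 t2 t3 t4 normal)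
  then have "P * Y = 0\<^sub>m n n" by (rule positive_op_trace_null[OF P Y])
  then have "A - P * X\<^sup>\<dagger> = 0\<^sub>m n n" using PY by simp
  then have eq: "A = P * X\<^sup>\<dagger>" using Ac PX' by (intro eq_matI) (auto simp: mat_eq_iff)
  \<comment> \<open>Both \<open>A = P * X\<close> and \<open>A = X * P\<close> hold now, so each
    product of \<open>A\<close> and \<open>P\<close> is \<open>P * X * P\<close>.\<close>
  have "A\<^sup>\<dagger> = X * P" using mat_adjoint_mult[OF Pc X'] Ph eq by simp
  then have "A = X * P" using Ah by simp
  then have "P * A = P * (X * P)" by simp
  also have "\<dots> = A * P" using assoc[OF Pc X Pc] PX by simp
  finally show ?thesis by simp
qed

section \<open>Contradiction for two non-commuting states\<close>

theorem theoremV7: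
  fixes n :: nat and p :: real and \<sigma>\<^sub>1 \<sigma>\<^sub>2 \<rho> \<tau> :: "complex mat" and E :: "complex mat \<Rightarrow> complex mat"
  assumes "completely_positive n (n * n) E" and "trace_preserving n E"
    and "0 < p" and "p < 1"
    and "density_op n \<sigma>\<^sub>1" and "density_op n \<sigma>\<^sub>2"
    and "\<sigma>\<^sub>1 * \<sigma>\<^sub>2 - \<sigma>\<^sub>2 * \<sigma>\<^sub>1 \<noteq> 0\<^sub>m n n"
    and "broadcasting_ensemble n E {(p, \<sigma>\<^sub>1), (1 - p, \<sigma>\<^sub>2)}"
    and "\<rho> = complex_of_real p \<cdot>\<^sub>m \<sigma>\<^sub>1 + complex_of_real (1 - p) \<cdot>\<^sub>m \<sigma>\<^sub>2"
    and "\<tau> = isomorphic_state n (n * n) \<rho> E"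
  shows "\<exists>a b c \<theta>. locally_transformable (n, n, n) \<tau> (a, b, c) \<theta> \<and>
           pure_entangled a b (reduced_12 (a, b, c) \<theta>) \<and>
           pure_entangled a c (reduced_13 (a, b, c) \<theta>)"
proof -
  have s: "positive_op n \<sigma>\<^sub>1" "positive_op n \<sigma>\<^sub>2" using assms(5,6) by (auto simp: density_op_def)
  then have c: "\<sigma>\<^sub>1 \<in> carrier_mat n n" "\<sigma>\<^sub>2 \<in> carrier_mat n n" by (auto simp: positive_op_def)
  have b: "broadcasting n E \<sigma>\<^sub>1" "broadcasting n E \<sigma>\<^sub>2"
    using assms(8) by (auto simp: broadcasting_ensemble_def)
  let ?p = "complex_of_real p" and ?q = "complex_of_real (1 - p)"
  have pq: "0 < ?p" "0 < ?q" using assms(3,4) by (auto simp: less_complex_def)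
  have \<rho>: "\<rho> \<in> carrier_mat n n" using c assms(9) by auto
  have E\<rho>: "E \<rho> = ?p \<cdot>\<^sub>m E \<sigma>\<^sub>1 + ?q \<cdot>\<^sub>m E \<sigma>\<^sub>2"
    using assms(1) c by (simp add: completely_positive_def linear_map_def assms(9))
  note Ec = completely_positive_carrier[OF assms(1)]
  \<comment> \<open>By linearity, \<open>E\<close> also broadcasts the mixture.\<close>
  have "ptrace_snd n n (E \<rho>) = ?p \<cdot>\<^sub>m ptrace_snd n n (E \<sigma>\<^sub>1) + ?q \<cdot>\<^sub>m ptrace_snd n n (E \<sigma>\<^sub>2)"
    "ptrace_fst n n (E \<rho>) = ?p \<cdot>\<^sub>m ptrace_fst n n (E \<sigma>\<^sub>1) + ?q \<cdot>\<^sub>m ptrace_fst n n (E \<sigma>\<^sub>2)"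
    unfolding E\<rho> using carrier_matD[OF Ec[OF c(1)]] carrier_matD[OF Ec[OF c(2)]]
    by (auto intro!: eq_matI simp: ptrace_snd_def ptrace_fst_def block_index_less sum.distrib sum_distrib_left)
  then have b\<rho>: "broadcasting n E \<rho>"
    using b by (simp add: broadcasting_def assms(9))
  have form: "(\<rho> *\<^sub>v v) \<bullet>c v = ?p * ((\<sigma>\<^sub>1 *\<^sub>v v) \<bullet>c v) + ?q * ((\<sigma>\<^sub>2 *\<^sub>v v) \<bullet>c v)"
    if v: "v \<in> carrier_vec n" for v
  proof -
    have "\<rho> *\<^sub>v v = ?p \<cdot>\<^sub>v (\<sigma>\<^sub>1 *\<^sub>v v) + ?q \<cdot>\<^sub>v (\<sigma>\<^sub>2 *\<^sub>v v)"
      using c v by (intro eq_vecI) (auto simp: assms(9) scalar_prod_def sum.distrib sum_subtractf sum_distrib_left algebra_simps)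
    moreover have "\<sigma>\<^sub>1 *\<^sub>v v \<in> carrier_vec n" "\<sigma>\<^sub>2 *\<^sub>v v \<in> carrier_vec n" using c v by auto
    ultimately show ?thesis
      using v by (simp add: add_scalar_prod_distrib[of _ n])
  qed
  have trace_form: "mat_trace (Y\<^sup>\<dagger> * (\<rho> * Y))
      = ?p * mat_trace (Y\<^sup>\<dagger> * (\<sigma>\<^sub>1 * Y)) + ?q * mat_trace (Y\<^sup>\<dagger> * (\<sigma>\<^sub>2 * Y))"
    if Y: "Y \<in> carrier_mat n n" for Y
    unfolding mat_trace_sandwich[OF \<rho> Y Y] mat_trace_sandwich[OF c(1) Y Y]
      mat_trace_sandwich[OF c(2) Y Y] sum_distrib_left sum.distrib[symmetric]
    using Y by (intro sum.cong refl form) auto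
  have P: "positive_op n \<rho>"
    unfolding positive_op_def
  proof (intro conjI ballI \<rho>)
    fix v :: "complex vec" assume v: "v \<in> carrier_vec n"
    have "(\<rho> *\<^sub>v v) \<bullet>c v = ?p * ((\<sigma>\<^sub>1 *\<^sub>v v) \<bullet>c v) + ?q * ((\<sigma>\<^sub>2 *\<^sub>v v) \<bullet>c v)"
      using v by (rule form)
    also have "0 \<le> \<dots>"
      using pq s v by (intro add_nonneg_nonneg mult_nonneg_nonneg) (auto simp: positive_op_def less_imp_le)
    finally show "0 \<le> (\<rho> *\<^sub>v v) \<bullet>c v" .
  qed
  \<comment> \<open>Both states contribute nonnegatively and with positive weight to the form of
    \<open>\<rho>\<close>, so \<open>\<sigma>\<^sub>1\<close> vanishes wherever
    \<open>\<rho>\<close> does.\<close>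
  have ker: "\<sigma>\<^sub>1 * N = 0\<^sub>m n n" if N: "N \<in> carrier_mat n n" and "\<rho> * N = 0\<^sub>m n n" for N
  proof (rule positive_op_trace_null[OF s(1) N])
    have "?p * mat_trace (N\<^sup>\<dagger> * (\<sigma>\<^sub>1 * N)) + ?q * mat_trace (N\<^sup>\<dagger> * (\<sigma>\<^sub>2 * N)) = 0"
      using trace_form[OF N] that by simp
    moreover have "0 \<le> ?p * mat_trace (N\<^sup>\<dagger> * (\<sigma>\<^sub>1 * N))" "0 \<le> ?q * mat_trace (N\<^sup>\<dagger> * (\<sigma>\<^sub>2 * N))"
      using pq positive_op_trace_nonneg[OF s(1) N] positive_op_trace_nonneg[OF s(2) N]
      by (auto intro: mult_nonneg_nonneg less_imp_le)
    ultimately have "?p * mat_trace (N\<^sup>\<dagger> * (\<sigma>\<^sub>1 * N)) = 0"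
      by (simp only: add_nonneg_eq_0_iff)
    then show "mat_trace (N\<^sup>\<dagger> * (\<sigma>\<^sub>1 * N)) = 0" using pq by auto
  qed
  have comm: "\<sigma>\<^sub>1 * \<rho> = \<rho> * \<sigma>\<^sub>1"
    by (rule broadcasting_commute[OF assms(1,2) P s(1) ker b\<rho> b(1)])
  \<comment> \<open>Commuting with the mixture is enough: the squares of
    \<open>\<sigma>\<^sub>1\<close> cancel, and the weight \<open>1 - p\<close> of the other
    products is not 0.\<close>
  have "\<sigma>\<^sub>1 * \<rho> = ?p \<cdot>\<^sub>m (\<sigma>\<^sub>1 * \<sigma>\<^sub>1) + ?q \<cdot>\<^sub>m (\<sigma>\<^sub>1 * \<sigma>\<^sub>2)"
    "\<rho> * \<sigma>\<^sub>1 = ?p \<cdot>\<^sub>m (\<sigma>\<^sub>1 * \<sigma>\<^sub>1) + ?q \<cdot>\<^sub>m (\<sigma>\<^sub>2 * \<sigma>\<^sub>1)"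
    using c by (simp_all add: assms(9) mult_add_distrib_mat[of _ n n _ n] add_mult_distrib_mat[of _ n n _ _ n]
      mult_smult_assoc_mat[of _ n n _ n] mult_smult_distrib[of _ n n _ n])
  then have "?p \<cdot>\<^sub>m (\<sigma>\<^sub>1 * \<sigma>\<^sub>1) + ?q \<cdot>\<^sub>m (\<sigma>\<^sub>1 * \<sigma>\<^sub>2) = ?p \<cdot>\<^sub>m (\<sigma>\<^sub>1 * \<sigma>\<^sub>1) + ?q \<cdot>\<^sub>m (\<sigma>\<^sub>2 * \<sigma>\<^sub>1)"
    using comm by simp
  then have "\<sigma>\<^sub>1 * \<sigma>\<^sub>2 = \<sigma>\<^sub>2 * \<sigma>\<^sub>1"
    using assms(4) c by (auto simp: mat_eq_iff simp del: index_mult_mat(1))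
  then have "\<sigma>\<^sub>1 * \<sigma>\<^sub>2 - \<sigma>\<^sub>2 * \<sigma>\<^sub>1 = 0\<^sub>m n n" using c by simp
  then show ?thesis using assms(7) by contradiction
qed

end
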